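(* Let $\mathbf{R}_u,\mathbf{R}_v,\mathbf{R}_w,\mathbf{R}_0\in\mathbb{R}^3$ and $\mathbf{R}(u,v,w)=\mathbf{R}_u u+\mathbf{R}_v v+\mathbf{R}_w w+\mathbf{R}_0$. Define $$c_n^m(u,v,w)=R_n^m(\mathbf{R}(u,v,w)),\qquad a_n^m=\int_0^1\int_0^{1-u}\int_0^{1-u-v}c_n^m(u,v,w)\,dw\,dv\,du,$$ $$b_n^m=\int_0^1\int_0^{1-v}d_n^m(u,v)\,du\,dv,\qquad d_n^m(u,v)=c_n^m(u,v,1-u-v).$$ Then for all integers $n\ge 1$ and $-n\le m\le n$, $$a_n^m=\frac{1}{n+3}\left(i\xi_0\,a_{n-1}^{m-1}+i\eta_0\,a_{n-1}^{m+1}-z_0\,a_{n-1}^m+b_n^m\right),$$ where, writing $\mathbf{R}_0=(x_0,y_0,z_0)$, $\xi_0=\frac{x_0+iy_0}{2}$ and $\eta_0=\frac{x_0-iy_0}{2}$.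
   Context: Harmonic polynomials: for $\mathbf{r}=(x,y,z)=r(\sin\theta\cos\varphi,\sin\theta\sin\varphi,\cos\theta)\in\mathbb{R}^3$, integers $n\ge 0$ and $-n\le m\le n$, $$R_n^m(\mathbf{r})=\frac{(-1)^n i^{|m|}}{(n+|m|)!}\,r^n P_n^{|m|}(\cos\theta)\,e^{im\varphi},$$ and $R_n^m\equiv 0$ for $|m|>n$; $i$ is the imaginary unit. Each $R_n^m$ is a homogeneous polynomial of degree $n$ in $(x,y,z)$ (this defines it also at points where $\theta,\varphi$ are not uniquely defined; $R_0^0\equiv 1$). The associated Legendre functions are, for integers $n,m\ge 0$, $$P_n^m(\mu)=\frac{(-1)^m(1-\mu^2)^{m/2}}{2^n n!}\frac{d^{m+n}}{d\mu^{m+n}}(\mu^2-1)^n.$$ Accordingly all indexed quantities built from $R_n^m$ vanish when $|m|>n$. *)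

theory Defs
  imports "HOL-Analysis.Analysis"
begin

text \<open>The factor \<open>(1 - \<mu>\<^sup>2)\<^bsup>m/2\<^esup>\<close> is written as a natural power of a square root, because
  \<open>0 powr 0 = 0\<close> would give the wrong value for \<open>m = 0\<close> at \<open>\<mu> = 1\<close> and \<open>\<mu> = -1\<close>.\<close>

definition assoc_legendre :: "nat \<Rightarrow> nat \<Rightarrow> real \<Rightarrow> real" where
  "assoc_legendre n m \<mu> =
     (-1) ^ m * sqrt (1 - \<mu>\<^sup>2) ^ m / (2 ^ n * fact n)
       * (deriv ^^ (m + n)) (\<lambda>t. (t\<^sup>2 - 1) ^ n) \<mu>"

text \<open>Here \<open>cos \<theta> = z / r\<close> and \<open>\<phi> = Arg (x + i y)\<close>. Where the angles are not determined, division
  by zero and \<open>Arg 0 = 0\<close> select some values; by lemma \<open>harmonic_R_spherical\<close> below the result does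
  not depend on this choice.\<close>

definition harmonic_R :: "nat \<Rightarrow> int \<Rightarrow> real ^ 3 \<Rightarrow> complex" where
  "harmonic_R n m r =
     (if \<bar>m\<bar> > int n then 0
      else (-1) ^ n * \<i> ^ nat \<bar>m\<bar> / fact (n + nat \<bar>m\<bar>)
             * of_real (norm r ^ n * assoc_legendre n (nat \<bar>m\<bar>) (r $ 3 / norm r))
             * exp (\<i> * of_int m * of_real (Arg (Complex (r $ 1) (r $ 2)))))"

definition affine_R ::
  "real ^ 3 \<Rightarrow> real ^ 3 \<Rightarrow> real ^ 3 \<Rightarrow> real ^ 3 \<Rightarrow> real \<Rightarrow> real \<Rightarrow> real \<Rightarrow> real ^ 3" where
  "affine_R Ru Rv Rw R0 u v w = u *\<^sub>R Ru + v *\<^sub>R Rv + w *\<^sub>R Rw + R0"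

definition coeff_c ::
  "real ^ 3 \<Rightarrow> real ^ 3 \<Rightarrow> real ^ 3 \<Rightarrow> real ^ 3 \<Rightarrow> nat \<Rightarrow> int \<Rightarrow> real \<Rightarrow> real \<Rightarrow> real \<Rightarrow> complex" where
  "coeff_c Ru Rv Rw R0 n m u v w = harmonic_R n m (affine_R Ru Rv Rw R0 u v w)"

definition coeff_d ::
  "real ^ 3 \<Rightarrow> real ^ 3 \<Rightarrow> real ^ 3 \<Rightarrow> real ^ 3 \<Rightarrow> nat \<Rightarrow> int \<Rightarrow> real \<Rightarrow> real \<Rightarrow> complex" where
  "coeff_d Ru Rv Rw R0 n m u v = coeff_c Ru Rv Rw R0 n m u v (1 - u - v)"

definition coeff_a ::
  "real ^ 3 \<Rightarrow> real ^ 3 \<Rightarrow> real ^ 3 \<Rightarrow> real ^ 3 \<Rightarrow> nat \<Rightarrow> int \<Rightarrow> complex" where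
  "coeff_a Ru Rv Rw R0 n m =
     integral {0..1} (\<lambda>u. integral {0..1 - u} (\<lambda>v. integral {0..1 - u - v} (\<lambda>w.
       coeff_c Ru Rv Rw R0 n m u v w)))"

definition coeff_b ::
  "real ^ 3 \<Rightarrow> real ^ 3 \<Rightarrow> real ^ 3 \<Rightarrow> real ^ 3 \<Rightarrow> nat \<Rightarrow> int \<Rightarrow> complex" where
  "coeff_b Ru Rv Rw R0 n m =
     integral {0..1} (\<lambda>v. integral {0..1 - v} (\<lambda>u. coeff_d Ru Rv Rw R0 n m u v))"

lemma assoc_legendre_pole: "\<mu>\<^sup>2 = 1 \<Longrightarrow> m > 0 \<Longrightarrow> assoc_legendre n m \<mu> = 0"
  by (simp add: assoc_legendre_def)

lemma harmonic_R_0: "harmonic_R 0 0 r = 1"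
  by (simp add: harmonic_R_def assoc_legendre_def)

lemma harmonic_R_spherical:
  fixes \<rho> \<theta> \<phi> :: real
  assumes "\<rho> \<ge> 0" "0 \<le> \<theta>" "\<theta> \<le> pi" "\<bar>m\<bar> \<le> int n"
  shows "harmonic_R n m
           (vector [\<rho> * sin \<theta> * cos \<phi>, \<rho> * sin \<theta> * sin \<phi>, \<rho> * cos \<theta>]) =
         (-1) ^ n * \<i> ^ nat \<bar>m\<bar> / fact (n + nat \<bar>m\<bar>)
           * of_real (\<rho> ^ n * assoc_legendre n (nat \<bar>m\<bar>) (cos \<theta>)) * exp (\<i> * of_int m * of_real \<phi>)"
    (is "harmonic_R n m ?r = _")
proof -
  have "norm ?r = sqrt (\<rho>\<^sup>2 * ((sin \<theta>)\<^sup>2 * ((cos \<phi>)\<^sup>2 + (sin \<phi>)\<^sup>2) + (cos \<theta>)\<^sup>2))"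
    unfolding norm_vec_def L2_set_def sum_3
    by (simp add: algebra_simps power_mult_distrib del: sin_cos_squared_add sin_cos_squared_add2)
  then have nr: "norm ?r = \<rho>"
    using assms(1) by simp
  show ?thesis
  proof (cases "\<rho> = 0")
    case True
    then show ?thesis
      using assms(4) nr by (cases "n = 0") (auto simp: harmonic_R_def assoc_legendre_def)
  next
    case \<rho>: False
    then have mu: "?r $ 3 / norm ?r = cos \<theta>"
      unfolding nr by simp
    show ?thesis
    proof (cases "sin \<theta> = 0 \<and> m \<noteq> 0")
      case True
      then have "(cos \<theta>)\<^sup>2 = 1"
        by (simp add: cos_squared_eq)
      then have "assoc_legendre n (nat \<bar>m\<bar>) (cos \<theta>) = 0"
        using True by (intro assoc_legendre_pole) auto
      then show ?thesis
        unfolding harmonic_R_def mu by simp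
    next
      case False
      have "exp (\<i> * of_int m * of_real (Arg (Complex (?r $ 1) (?r $ 2))))
              = exp (\<i> * of_int m * of_real \<phi>)"
      proof (cases "m = 0")
        case False
        have pos: "\<rho> * sin \<theta> > 0"
          using False \<open>\<not> (sin \<theta> = 0 \<and> m \<noteq> 0)\<close> \<rho> assms sin_ge_zero[of \<theta>]
          by (intro mult_pos_pos) auto
        define z where "z = Complex (?r $ 1) (?r $ 2)"
        have z: "z = of_real (\<rho> * sin \<theta>) * cis \<phi>"
          by (simp add: z_def complex_eq_iff)
        have "z \<noteq> 0" "sgn z = cis \<phi>"
          using pos by (auto simp: z sgn_mult sgn_eq norm_mult simp flip: of_real_mult)
        then have "cis (Arg z) = cis \<phi>"
          using cis_Arg by metis
        then have "cis (Arg z) powi m = cis \<phi> powi m"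
          by simp
        then show ?thesis
          unfolding z_def[symmetric]
          unfolding cis_power_int by (simp add: cis_conv_exp mult_ac)
      qed simp
      then show ?thesis
        using assms(4) \<rho> unfolding harmonic_R_def mu nr by simp
    qed
  qed
qed

end

theory Submission
  imports Defs
begin

text \<open>With \<open>\<xi> = (x + i y) / 2\<close> and \<open>\<eta> = (x - i y) / 2\<close>, the number \<open>n! R_n^m\<close> is the coefficient of
  \<open>t^m\<close> in \<open>(i \<eta> / t - z + i \<xi> t)^n\<close>. Differentiating this power expresses the Euler operator
  \<open>u \<partial>\<^sub>u + v \<partial>\<^sub>v + w \<partial>\<^sub>w\<close> applied to \<open>c_n^m\<close> as \<open>n c_n^m\<close> minus the terms of degree \<open>n - 1\<close>
  contributed by \<open>R0\<close>. The divergence theorem for the field \<open>(u, v, w) c_n^m\<close> on the standard simplex,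
  which is checked on monomials through beta integrals, then gives the recurrence.\<close>

section \<open>Coefficients of powers of a Laurent trinomial\<close>

text \<open>\<open>trinom c a d n m\<close> is the coefficient of \<open>t^m\<close> in the Laurent polynomial
  \<open>(c / t + a + d t)^n\<close>.\<close>

primrec trinom :: "'a::comm_ring_1 \<Rightarrow> 'a \<Rightarrow> 'a \<Rightarrow> nat \<Rightarrow> int \<Rightarrow> 'a" where
  "trinom c a d 0 m = (if m = 0 then 1 else 0)"
| "trinom c a d (Suc n) m =
     c * trinom c a d n (m + 1) + a * trinom c a d n m + d * trinom c a d n (m - 1)"

lemma trinom_eq_0: "\<bar>m\<bar> > int n \<Longrightarrow> trinom c a d n m = 0"
  by (induction n arbitrary: m) auto

lemma trinom_lowest: "trinom c a d n (- int n) = c ^ n"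
  by (induction n) (auto simp: trinom_eq_0)

text \<open>Replacing t by 1/t exchanges the two outer coefficients. This reduces negative orders to
  positive ones.\<close>

lemma trinom_reflect: "trinom c a d n (- m) = trinom d a c n m"
proof (induction n arbitrary: m)
  case (Suc n)
  have "trinom c a d (Suc n) (- m) =
      c * trinom c a d n (- (m - 1)) + a * trinom c a d n (- m) + d * trinom c a d n (- (m + 1))"
    by simp
  also have "\<dots> = trinom d a c (Suc n) m"
    unfolding Suc.IH by simp
  finally show ?case .
qed auto

lemma trinom_scale: "trinom (s * c) (s * a) (s * d) n m = s ^ n * trinom c a d n m"
  by (induction n arbitrary: m) (auto simp: algebra_simps)

text \<open>Rescaling the formal variable by the factor \<open>t\<close> multiplies the coefficient
  of its m-th power by \<open>t powi m\<close>.\<close>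

lemma trinom_substitute:
  fixes t :: "'a::field"
  assumes "t \<noteq> 0"
  shows "trinom (c / t) a (t * d) n m = t powi m * trinom c a d n m"
proof (induction n arbitrary: m)
  case (Suc n)
  have "t powi (m + 1) = t * t powi m" "t * t powi (m - 1) = t powi m"
    using assms by (auto simp: power_int_add power_int_diff)
  then show ?case
    using assms unfolding trinom.simps Suc.IH
    by (simp add: field_simps)
qed auto

text \<open>Without the 1/t term no negative power arises. The next two lemmas likewise treat
  degenerate trinomials; they cover the poles, where the factor for \<open>trinom_substitute\<close>
  would be zero.\<close>

lemma trinom_linear_negative: "m < 0 \<Longrightarrow> trinom 0 a d n m = 0"
  by (induction n arbitrary: m) auto

lemma trinom_linear_0: "trinom 0 a d n 0 = a ^ n"
  by (induction n) (auto simp: trinom_linear_negative)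

lemma trinom_monomial: "trinom 0 a 0 n m = (if m = 0 then a ^ n else 0)"
  by (induction n arbitrary: m) auto

lemma of_real_trinom:
  "of_real (trinom c a d n m) =
     (trinom (of_real c) (of_real a) (of_real d) n m :: 'a::{real_algebra_1,comm_ring_1})"
  by (induction n arbitrary: m) auto

text \<open>Apply t d/dt to (c/t + a + d t)^(n+1). On coefficients it multiplies by m; by the chain
  rule it gives (n+1) (d t - c/t) (c/t + a + d t)^n.\<close>

lemma trinom_index:
  "of_int m * trinom c a d (Suc n) m =
     of_nat (Suc n) * (d * trinom c a d n (m - 1) - c * trinom c a d n (m + 1))"
proof (induction n arbitrary: m)
  case (Suc n)
  \<comment> \<open>The factor must match the shifted index before the induction hypothesis applies
    at \<open>m + 1\<close> and \<open>m - 1\<close>.\<close>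
  have shift: "of_int m * trinom c a d (Suc n) (m + 1)
        = of_int (m + 1) * trinom c a d (Suc n) (m + 1) - trinom c a d (Suc n) (m + 1)"
      "of_int m * trinom c a d (Suc n) (m - 1)
        = of_int (m - 1) * trinom c a d (Suc n) (m - 1) + trinom c a d (Suc n) (m - 1)"
    by (simp_all add: algebra_simps)
  have "of_int m * trinom c a d (Suc (Suc n)) m =
      c * (of_int m * trinom c a d (Suc n) (m + 1)) + a * (of_int m * trinom c a d (Suc n) m)
      + d * (of_int m * trinom c a d (Suc n) (m - 1))"
    unfolding trinom.simps(2)[of c a d "Suc n"] by (simp only: algebra_simps)
  also have "\<dots> = of_nat (Suc (Suc n)) *
      (d * trinom c a d (Suc n) (m - 1) - c * trinom c a d (Suc n) (m + 1))"
    unfolding shift Suc.IH by (simp add: algebra_simps)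
  finally show ?case .
qed (auto simp flip: eq_neg_iff_add_eq_0)

text \<open>Chain rule for the n-th power: the inner derivative c'/t + a' + d' t shifts the indices
  of the (n-1)-st power. For n = 0 the factor \<open>of_nat n\<close> makes the truncated
  \<open>n - 1\<close> harmless.\<close>

lemma has_field_derivative_trinom:
  fixes c a d :: "'a::real_normed_field \<Rightarrow> 'a"
  assumes [derivative_intros]: "(c has_field_derivative c') (at x)"
      "(a has_field_derivative a') (at x)" "(d has_field_derivative d') (at x)"
  shows "((\<lambda>x. trinom (c x) (a x) (d x) n m) has_field_derivative
      of_nat n * (c' * trinom (c x) (a x) (d x) (n - 1) (m + 1)
        + a' * trinom (c x) (a x) (d x) (n - 1) m
        + d' * trinom (c x) (a x) (d x) (n - 1) (m - 1))) (at x)"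
proof (induction n arbitrary: m)
  case (Suc n)
  note [derivative_intros] = Suc.IH
  show ?case
    unfolding trinom.simps
    apply (rule derivative_eq_intros refl)+
    by (cases n) (simp_all add: algebra_simps)
qed auto

section \<open>Legendre functions and harmonic polynomials as trinomial coefficients\<close>

text \<open>Taylor expansion of \<open>(t\<^sup>2 - 1)^n\<close> at \<open>t\<close>: \<open>((t + h)\<^sup>2 - 1)^n = h^n ((t\<^sup>2 - 1) / h + 2 t + h)^n\<close>.\<close>

lemma higher_deriv_trinom:
  "(deriv ^^ j) (\<lambda>t::real. (t\<^sup>2 - 1) ^ n) =
     (\<lambda>t. fact j * trinom (t\<^sup>2 - 1) (2 * t) 1 n (int j - int n))"
proof (induction j)
  case 0
  then show ?case by (simp add: trinom_lowest)
next
  case (Suc j)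
  define m where "m = int j - int n"
  have "deriv (\<lambda>t. fact j * trinom (t\<^sup>2 - 1) (2 * t) 1 n m) t =
      fact (Suc j) * trinom (t\<^sup>2 - 1) (2 * t) 1 n (m + 1)" for t :: real
  proof -
    have "((\<lambda>t. trinom (t\<^sup>2 - 1) (2 * t) 1 n m) has_field_derivative
        of_nat n * (2 * t * trinom (t\<^sup>2 - 1) (2 * t) 1 (n - 1) (m + 1)
        + 2 * trinom (t\<^sup>2 - 1) (2 * t) 1 (n - 1) m
        + 0 * trinom (t\<^sup>2 - 1) (2 * t) 1 (n - 1) (m - 1))) (at t)"
      by (rule has_field_derivative_trinom) (auto intro!: derivative_eq_intros)
    also have "of_nat n * (2 * t * trinom (t\<^sup>2 - 1) (2 * t) 1 (n - 1) (m + 1)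
        + 2 * trinom (t\<^sup>2 - 1) (2 * t) 1 (n - 1) m
        + 0 * trinom (t\<^sup>2 - 1) (2 * t) 1 (n - 1) (m - 1)) =
        of_nat (Suc j) * trinom (t\<^sup>2 - 1) (2 * t) 1 n (m + 1)"
    proof (cases n)
      case 0
      then show ?thesis by (simp add: m_def)
    next
      case (Suc k)
      \<comment> \<open>This splitting lets \<open>trinom_index\<close> treat the first summand and
        the recursion the second; their terms with index \<open>m + 2\<close> cancel.\<close>
      have "real (Suc j) = of_int (m + 1) + of_nat (Suc k)"
        by (simp add: m_def Suc)
      then have "of_nat (Suc j) * trinom (t\<^sup>2 - 1) (2 * t) 1 n (m + 1) =
          of_int (m + 1) * trinom (t\<^sup>2 - 1) (2 * t) 1 (Suc k) (m + 1)
          + of_nat (Suc k) * trinom (t\<^sup>2 - 1) (2 * t) 1 (Suc k) (m + 1)"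
        by (simp only: Suc distrib_right)
      then show ?thesis
        unfolding trinom_index by (simp add: Suc algebra_simps)
    qed
    finally have "((\<lambda>t. fact j * trinom (t\<^sup>2 - 1) (2 * t) 1 n m) has_field_derivative
        fact j * (of_nat (Suc j) * trinom (t\<^sup>2 - 1) (2 * t) 1 n (m + 1))) (at t)"
      by (rule DERIV_cmult)
    then show ?thesis
      by (simp add: DERIV_imp_deriv algebra_simps)
  qed
  moreover have "int (Suc j) - int n = m + 1"
    by (simp add: m_def)
  ultimately show ?case
    by (simp only: funpow.simps o_apply Suc.IH flip: m_def)
qed

lemma assoc_legendre_trinom:
  "assoc_legendre n k \<mu> = (-1) ^ k * sqrt (1 - \<mu>\<^sup>2) ^ k * fact (n + k) / (2 ^ n * fact n)
     * trinom (\<mu>\<^sup>2 - 1) (2 * \<mu>) 1 n (int k)"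
  by (simp add: assoc_legendre_def higher_deriv_trinom add.commute)

text \<open>By \<open>assoc_legendre_trinom\<close>, the right side comes from ((\<mu>^2 - 1)/t + 2
  \<mu> + t)^n. Scaling by \<open>\<kappa>\<close> and replacing t by \<open>\<alpha> * t\<close>
  yields the trinomial on the left. An arbitrary inverse pair \<open>e\<close>, \<open>e'\<close>
  serves both signs of the order.\<close>

lemma trinom_legendre:
  fixes N \<mu> s :: real and e e' :: complex
  assumes "s = sqrt (1 - \<mu>\<^sup>2)" "\<mu>\<^sup>2 \<le> 1" "e * e' = 1"
  shows "trinom (\<i> * (of_real (N * s) * e' / 2)) (- of_real (N * \<mu>))
          (\<i> * (of_real (N * s) * e / 2)) n (int k) / fact n =
      (-1) ^ n * \<i> ^ k / fact (n + k) * of_real (N ^ n * assoc_legendre n k \<mu>) * e ^ k"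
proof -
  define T where "T = trinom (of_real (\<mu>\<^sup>2 - 1)) (of_real (2 * \<mu>)) (1::complex) n (int k)"
  define \<kappa> \<alpha> where "\<kappa> = - complex_of_real N / 2" and "\<alpha> = - \<i> * of_real s * e"
  have s2: "of_real (\<mu>\<^sup>2 - 1) = - (complex_of_real s)\<^sup>2"
    using assms(1,2) by (simp flip: of_real_power)
  have "trinom (\<i> * (of_real (N * s) * e' / 2)) (- of_real (N * \<mu>))
      (\<i> * (of_real (N * s) * e / 2)) n (int k) = \<kappa> ^ n * (\<alpha> ^ k * T)"
  proof (cases "s = 0")
    \<comment> \<open>On the z-axis \<open>\<alpha>\<close> is zero and cannot be substituted. The
      outer coefficients on the left vanish as well, so only k = 0 contributes.\<close>
    case True
    then have "T = trinom 0 (of_real (2 * \<mu>)) 1 n (int k)"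
      unfolding T_def s2 by simp
    moreover have "\<kappa> ^ n * of_real (2 * \<mu>) ^ n = (- of_real (N * \<mu>)) ^ n"
      unfolding power_mult_distrib[symmetric] by (simp add: \<kappa>_def)
    ultimately show ?thesis
      using True by (cases "k = 0") (simp_all add: \<alpha>_def trinom_monomial trinom_linear_0)
  next
    case False
    have \<alpha>: "\<alpha> \<noteq> 0"
      using False assms(3) by (auto simp: \<alpha>_def)
    have "\<i> * (of_real (N * s) * e' / 2) * \<alpha> = of_real N / 2 * (of_real s)\<^sup>2 * (e * e')"
      by (simp add: \<alpha>_def power2_eq_square mult_ac)
    also have "\<dots> = \<kappa> * of_real (\<mu>\<^sup>2 - 1)"
      unfolding s2 assms(3) by (simp add: \<kappa>_def)
    finally have "\<i> * (of_real (N * s) * e' / 2) = \<kappa> * (of_real (\<mu>\<^sup>2 - 1) / \<alpha>)"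
      by (simp only: times_divide_eq_right nonzero_eq_divide_eq[OF \<alpha>])
    moreover have "- of_real (N * \<mu>) = \<kappa> * of_real (2 * \<mu>)"
      by (simp add: \<kappa>_def)
    moreover have "\<i> * (of_real (N * s) * e / 2) = \<kappa> * (\<alpha> * 1)"
      by (simp add: \<kappa>_def \<alpha>_def)
    ultimately show ?thesis
      by (simp only: trinom_scale trinom_substitute[OF \<alpha>] T_def power_int_of_nat)
  qed
  also have "\<kappa> ^ n = (-1) ^ n * of_real N ^ n / 2 ^ n"
    unfolding \<kappa>_def by (simp only: power_divide power_minus[of "complex_of_real N"])
  also have "\<alpha> ^ k = (-1) ^ k * \<i> ^ k * of_real s ^ k * e ^ k"
    unfolding \<alpha>_def by (simp only: power_mult_distrib power_minus[of \<i>])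
  finally show ?thesis
    unfolding assoc_legendre_trinom assms(1)[symmetric] by (simp add: T_def of_real_trinom power_mult_distrib mult_ac)
qed

text \<open>Eliminates the angles: the three coefficients are linear in the Cartesian coordinates,
  so polynomiality becomes visible.\<close>

lemma harmonic_R_trinom:
  "harmonic_R n m r =
     trinom (\<i> * ((of_real (r $ 1) - \<i> * of_real (r $ 2)) / 2)) (- of_real (r $ 3))
       (\<i> * ((of_real (r $ 1) + \<i> * of_real (r $ 2)) / 2)) n m / fact n"
proof (cases "\<bar>m\<bar> > int n")
  case True
  then show ?thesis by (simp add: harmonic_R_def trinom_eq_0)
next
  case m: False
  define N \<mu> s where "N = norm r" and "\<mu> = r $ 3 / N" and "s = sqrt (1 - \<mu>\<^sup>2)"
  define p where "p = Complex (r $ 1) (r $ 2)"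
  define e where "e = cis (Arg p)"
  have N2: "N\<^sup>2 = (r $ 1)\<^sup>2 + (r $ 2)\<^sup>2 + (r $ 3)\<^sup>2"
    by (simp add: N_def norm_vec_def L2_set_def sum_3)
  \<comment> \<open>At the origin division by zero gives \<mu> = 0, and both this equation and the
    bound on \<mu> still hold.\<close>
  have z: "N * \<mu> = r $ 3"
    using component_le_norm_cart[of r 3] by (cases "N = 0") (auto simp: \<mu>_def N_def)
  have \<mu>: "\<mu>\<^sup>2 \<le> 1"
    using component_le_norm_cart[of r 3]
    by (simp add: \<mu>_def N_def abs_square_le_1 divide_le_eq)
  \<comment> \<open>With \<mu> as cosine of the polar angle, \<open>N * s\<close> is the distance
    from the z-axis.\<close>
  have "N * s = norm p"
  proof -
    have "N * s = sqrt (N\<^sup>2 * (1 - \<mu>\<^sup>2))"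
      by (simp add: s_def real_sqrt_mult N_def)
    also have "N\<^sup>2 * (1 - \<mu>\<^sup>2) = N\<^sup>2 - (N * \<mu>)\<^sup>2"
      by (simp add: power_mult_distrib right_diff_distrib)
    also have "\<dots> = (r $ 1)\<^sup>2 + (r $ 2)\<^sup>2"
      by (simp add: z N2)
    finally show ?thesis
      by (simp add: p_def cmod_def)
  qed
  then have p: "p = of_real (N * s) * e"
    by (metis e_def rcis_cmod_Arg rcis_def)
  have pe: "of_real (r $ 1) + \<i> * of_real (r $ 2) = of_real (N * s) * e"
    unfolding p[symmetric] p_def by (simp add: complex_eq_iff)
  have pe': "of_real (r $ 1) - \<i> * of_real (r $ 2) = of_real (N * s) * cnj e"
    using arg_cong[OF pe, of cnj] by simp
  have ee: "e * cnj e = 1" "cnj e * e = 1"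
    by (simp_all add: e_def cis_cnj cis_mult)
  define k where "k = nat \<bar>m\<bar>"
  have H: "harmonic_R n m r = (-1) ^ n * \<i> ^ k / fact (n + k)
       * of_real (N ^ n * assoc_legendre n k \<mu>) * e powi m"
  proof -
    have "exp (\<i> * of_int m * of_real (Arg p)) = e powi m"
      unfolding e_def cis_power_int by (simp add: cis_conv_exp mult_ac)
    then show ?thesis
      using m by (simp add: harmonic_R_def k_def N_def \<mu>_def p_def)
  qed
  show ?thesis
  proof (cases "m \<ge> 0")
    case True
    then have mk: "m = int k"
      by (simp add: k_def)
    show ?thesis
      unfolding H pe pe' z[symmetric]
      unfolding mk
      using trinom_legendre[OF s_def \<mu> ee(1), of N n k] by simp
  next
    case False
    then have mk: "m = - int k"
      by (simp add: k_def)
    \<comment> \<open>On the unit circle the inverse is the conjugate. Reflection swaps the outer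
      coefficients, so \<open>trinom_legendre\<close> applies with \<open>e\<close> and
      \<open>cnj e\<close> exchanged.\<close>
    have "e powi m = cnj e ^ k"
      unfolding mk by (simp add: power_int_minus e_def cis_cnj flip: power_inverse)
    then show ?thesis
      unfolding H \<open>e powi m = cnj e ^ k\<close> pe pe' z[symmetric]
      unfolding mk trinom_reflect
      using trinom_legendre[OF s_def \<mu> ee(2), of N n k] by simp
  qed
qed

section \<open>Polynomials under the Euler operator\<close>

text \<open>\<open>euler_poly G G'\<close>: \<open>G\<close> is a polynomial and \<open>G'\<close> its image under the Euler operator
  \<open>u \<partial>\<^sub>u + v \<partial>\<^sub>v + w \<partial>\<^sub>w\<close>.\<close>

inductive euler_poly ::
  "(real \<Rightarrow> real \<Rightarrow> real \<Rightarrow> complex) \<Rightarrow> (real \<Rightarrow> real \<Rightarrow> real \<Rightarrow> complex) \<Rightarrow> bool" where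
  monomial: "euler_poly (\<lambda>u v w. of_real (u ^ i * v ^ j * w ^ k))
      (\<lambda>u v w. of_nat (i + j + k) * of_real (u ^ i * v ^ j * w ^ k))"
| scale: "euler_poly G G' \<Longrightarrow>
    euler_poly (\<lambda>u v w. x * G u v w) (\<lambda>u v w. x * G' u v w)"
| add: "euler_poly G G' \<Longrightarrow> euler_poly H H' \<Longrightarrow>
    euler_poly (\<lambda>u v w. G u v w + H u v w) (\<lambda>u v w. G' u v w + H' u v w)"

lemma euler_poly_cong:
  assumes "euler_poly G G'" "\<And>u v w. G u v w = H u v w" "\<And>u v w. G' u v w = H' u v w"
  shows "euler_poly H H'"
proof -
  have "G = H" "G' = H'" using assms(2,3) by (auto simp: fun_eq_iff)
  then show ?thesis using assms(1) by simp
qed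

text \<open>Product rule: the Euler operator fixes each coordinate function.\<close>

lemma euler_poly_times_coordinate:
  assumes "euler_poly G G'"
  shows "euler_poly (\<lambda>u v w. of_real u * G u v w) (\<lambda>u v w. of_real u * (G u v w + G' u v w))"
    and "euler_poly (\<lambda>u v w. of_real v * G u v w) (\<lambda>u v w. of_real v * (G u v w + G' u v w))"
    and "euler_poly (\<lambda>u v w. of_real w * G u v w) (\<lambda>u v w. of_real w * (G u v w + G' u v w))"
  using assms
proof (induction)
  case (monomial i j k)
  case 1
  show ?case
    by (rule euler_poly_cong[OF euler_poly.monomial[of "Suc i" j k]]) (simp_all add: algebra_simps)
  case 2
  show ?case
    by (rule euler_poly_cong[OF euler_poly.monomial[of i "Suc j" k]]) (simp_all add: algebra_simps)
  case 3
  show ?case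
    by (rule euler_poly_cong[OF euler_poly.monomial[of i j "Suc k"]]) (simp_all add: algebra_simps)
next
  case (scale G G' x)
  case 1
  show ?case
    by (rule euler_poly_cong[OF euler_poly.scale[OF scale.IH(1), of x]]) (simp_all add: algebra_simps)
  case 2
  show ?case
    by (rule euler_poly_cong[OF euler_poly.scale[OF scale.IH(2), of x]]) (simp_all add: algebra_simps)
  case 3
  show ?case
    by (rule euler_poly_cong[OF euler_poly.scale[OF scale.IH(3), of x]]) (simp_all add: algebra_simps)
next
  case (add G G' H H')
  case 1
  show ?case
    by (rule euler_poly_cong[OF euler_poly.add[OF add.IH(1) add.IH(4)]]) (simp_all add: algebra_simps)
  case 2
  show ?case
    by (rule euler_poly_cong[OF euler_poly.add[OF add.IH(2) add.IH(5)]]) (simp_all add: algebra_simps)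
  case 3
  show ?case
    by (rule euler_poly_cong[OF euler_poly.add[OF add.IH(3) add.IH(6)]]) (simp_all add: algebra_simps)
qed

text \<open>Product rule again: the Euler operator kills the constant \<open>t\<close> and fixes the
  linear part, so it maps \<open>l\<close> to \<open>l - t\<close>.\<close>

lemma euler_poly_times_affine:
  assumes G: "euler_poly G G'"
    and l: "\<And>u v w. l u v w = of_real u * p + of_real v * q + of_real w * s + t"
  shows "euler_poly (\<lambda>u v w. l u v w * G u v w)
           (\<lambda>u v w. (l u v w - t) * G u v w + l u v w * G' u v w)"
  by (rule euler_poly_cong[OF
        euler_poly.add[OF euler_poly.add[OF
            euler_poly.scale[OF euler_poly_times_coordinate(1)[OF G], of p]
            euler_poly.scale[OF euler_poly_times_coordinate(2)[OF G], of q]]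
          euler_poly.add[OF
            euler_poly.scale[OF euler_poly_times_coordinate(3)[OF G], of s]
            euler_poly.scale[OF G, of t]]]])
    (simp_all add: l algebra_simps)

text \<open>The analogue of \<open>has_field_derivative_trinom\<close> for the Euler derivation,
  which sends the affine coefficients to their linear parts \<open>c - c0\<close>,
  \<open>a - a0\<close>, \<open>d - d0\<close>.\<close>

lemma euler_poly_trinom:
  assumes c: "\<And>u v w. c u v w = of_real u * c1 + of_real v * c2 + of_real w * c3 + c0"
    and a: "\<And>u v w. a u v w = of_real u * a1 + of_real v * a2 + of_real w * a3 + a0"
    and d: "\<And>u v w. d u v w = of_real u * d1 + of_real v * d2 + of_real w * d3 + d0"
  shows "euler_poly (\<lambda>u v w. trinom (c u v w) (a u v w) (d u v w) n m)
     (\<lambda>u v w. of_nat n * ((c u v w - c0) * trinom (c u v w) (a u v w) (d u v w) (n - 1) (m + 1)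
        + (a u v w - a0) * trinom (c u v w) (a u v w) (d u v w) (n - 1) m
        + (d u v w - d0) * trinom (c u v w) (a u v w) (d u v w) (n - 1) (m - 1)))"
proof (induction n arbitrary: m)
  case 0
  show ?case
    by (rule euler_poly_cong[OF euler_poly.scale[OF euler_poly.monomial[of 0 0 0],
            of "if m = 0 then 1 else 0"]]) simp_all
next
  case (Suc n)
  show ?case
    by (rule euler_poly_cong[OF
          euler_poly.add[OF euler_poly.add[OF
              euler_poly_times_affine[OF Suc.IH[of "m + 1"] c]
              euler_poly_times_affine[OF Suc.IH[of m] a]]
            euler_poly_times_affine[OF Suc.IH[of "m - 1"] d]]])
      (simp, cases n, simp_all add: algebra_simps)
qed

section \<open>Beta integrals and iterated integrals over simplex and triangle\<close>

text \<open>Integration by parts: x^(i+1) (L-x)^(j+1) vanishes at both ends, which trades one power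
  of L-x for one of x until j = 0.\<close>

lemma has_integral_beta:
  fixes L :: real
  assumes "L \<ge> 0"
  shows "((\<lambda>x. x ^ i * (L - x) ^ j) has_integral
           fact i * fact j / fact (i + j + 1) * L ^ (i + j + 1)) {0..L}"
proof (induction j arbitrary: i)
  case 0
  have "((\<lambda>x. x ^ i) has_integral L ^ Suc i / of_nat (Suc i) - 0 ^ Suc i / of_nat (Suc i)) {0..L}"
    by (rule fundamental_theorem_of_calculus[OF assms])
      (auto intro!: derivative_eq_intros simp flip: has_real_derivative_iff_has_vector_derivative
        simp del: of_nat_Suc power_Suc)
  then show ?case
    by (simp add: fact_Suc del: of_nat_Suc power_Suc)
next
  case (Suc j)
  let ?f = "\<lambda>x. of_nat (Suc i) * (x ^ i * (L - x) ^ Suc j) - of_nat (Suc j) * (x ^ Suc i * (L - x) ^ j)"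
  have "((\<lambda>x. x ^ Suc i * (L - x) ^ Suc j) has_real_derivative ?f x) (at x within {0..L})" for x
    by (rule derivative_eq_intros refl)+ (simp add: mult_ac del: of_nat_Suc power_Suc)
  then have "(?f has_integral L ^ Suc i * (L - L) ^ Suc j - 0 ^ Suc i * (L - 0) ^ Suc j) {0..L}"
    by (intro fundamental_theorem_of_calculus[OF assms])
      (simp add: has_real_derivative_iff_has_vector_derivative)
  then have "(?f has_integral 0) {0..L}"
    by simp
  from has_integral_add[OF this has_integral_mult_right[OF Suc.IH[of "Suc i"], of "of_nat (Suc j)"]]
  have "((\<lambda>x. of_nat (Suc i) * (x ^ i * (L - x) ^ Suc j)) has_integral
      of_nat (Suc j) * (fact (Suc i) * fact j / fact (Suc i + j + 1) * L ^ (Suc i + j + 1))) {0..L}"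
    by (simp del: of_nat_Suc power_Suc fact_Suc)
  from has_integral_mult_right[OF this, of "1 / of_nat (Suc i)"]
  show ?case
    by (simp add: fact_Suc[of i] fact_Suc[of j] mult_ac del: fact_Suc of_nat_Suc power_Suc)
qed

text \<open>Spelling out the inner integrals makes additivity immediate, with no appeal to
  integrability of parameter integrals.\<close>

definition has_simplex_integral ::
  "(real \<Rightarrow> real \<Rightarrow> real \<Rightarrow> complex) \<Rightarrow> complex \<Rightarrow> bool" where
  "has_simplex_integral G I \<longleftrightarrow> (\<exists>A B.
     (\<forall>u\<in>{0..1}. \<forall>v\<in>{0..1 - u}. (G u v has_integral A u v) {0..1 - u - v}) \<and>
     (\<forall>u\<in>{0..1}. (A u has_integral B u) {0..1 - u}) \<and> (B has_integral I) {0..1})"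

definition has_triangle_integral :: "(real \<Rightarrow> real \<Rightarrow> complex) \<Rightarrow> complex \<Rightarrow> bool" where
  "has_triangle_integral G I \<longleftrightarrow> (\<exists>A.
     (\<forall>v\<in>{0..1}. ((\<lambda>u. G u v) has_integral A v) {0..1 - v}) \<and> (A has_integral I) {0..1})"

text \<open>The witnesses \<open>A\<close> and \<open>B\<close> equal the inner integrals on the
  domain of the outer ones, which is all that those depend on.\<close>

lemma has_simplex_integral_integral:
  assumes "has_simplex_integral G I"
  shows "integral {0..1} (\<lambda>u. integral {0..1 - u} (\<lambda>v. integral {0..1 - u - v} (G u v))) = I"
proof -
  obtain A B where
    A: "\<And>u v. u \<in> {0..1} \<Longrightarrow> v \<in> {0..1 - u} \<Longrightarrow> (G u v has_integral A u v) {0..1 - u - v}" and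
    B: "\<And>u. u \<in> {0..1} \<Longrightarrow> (A u has_integral B u) {0..1 - u}" and
    I: "(B has_integral I) {0..1}"
    using assms unfolding has_simplex_integral_def by blast
  have "integral {0..1 - u} (\<lambda>v. integral {0..1 - u - v} (G u v)) = B u" if "u \<in> {0..1}" for u
  proof -
    have "integral {0..1 - u} (\<lambda>v. integral {0..1 - u - v} (G u v)) = integral {0..1 - u} (A u)"
      by (rule integral_cong) (simp add: integral_unique[OF A[OF that]])
    then show ?thesis using B[OF that] by (simp add: integral_unique)
  qed
  then have "integral {0..1} (\<lambda>u. integral {0..1 - u} (\<lambda>v. integral {0..1 - u - v} (G u v)))
      = integral {0..1} B"
    by (rule integral_cong)
  then show ?thesis using I by (simp add: integral_unique)
qed

lemma has_triangle_integral_integral: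
  assumes "has_triangle_integral G I"
  shows "integral {0..1} (\<lambda>v. integral {0..1 - v} (\<lambda>u. G u v)) = I"
proof -
  obtain A where
    A: "\<And>v. v \<in> {0..1} \<Longrightarrow> ((\<lambda>u. G u v) has_integral A v) {0..1 - v}" and
    I: "(A has_integral I) {0..1}"
    using assms unfolding has_triangle_integral_def by blast
  have "integral {0..1} (\<lambda>v. integral {0..1 - v} (\<lambda>u. G u v)) = integral {0..1} A"
    by (rule integral_cong) (simp add: integral_unique[OF A])
  then show ?thesis using I by (simp add: integral_unique)
qed

lemma has_simplex_integral_add:
  assumes "has_simplex_integral G I" "has_simplex_integral H J"
  shows "has_simplex_integral (\<lambda>u v w. G u v w + H u v w) (I + J)"
proof -
  obtain A B where "\<forall>u\<in>{0..1}. \<forall>v\<in>{0..1 - u}. (G u v has_integral A u v) {0..1 - u - v}"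
    "\<forall>u\<in>{0..1}. (A u has_integral B u) {0..1 - u}" "(B has_integral I) {0..1}"
    using assms(1) unfolding has_simplex_integral_def by blast
  moreover obtain C D where "\<forall>u\<in>{0..1}. \<forall>v\<in>{0..1 - u}. (H u v has_integral C u v) {0..1 - u - v}"
    "\<forall>u\<in>{0..1}. (C u has_integral D u) {0..1 - u}" "(D has_integral J) {0..1}"
    using assms(2) unfolding has_simplex_integral_def by blast
  ultimately show ?thesis
    unfolding has_simplex_integral_def
    by (intro exI[of _ "\<lambda>u v. A u v + C u v"] exI[of _ "\<lambda>u. B u + D u"])
      (simp add: has_integral_add)
qed

lemma has_simplex_integral_scale:
  assumes "has_simplex_integral G I"
  shows "has_simplex_integral (\<lambda>u v w. x * G u v w) (x * I)"
proof -
  obtain A B where "\<forall>u\<in>{0..1}. \<forall>v\<in>{0..1 - u}. (G u v has_integral A u v) {0..1 - u - v}"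
    "\<forall>u\<in>{0..1}. (A u has_integral B u) {0..1 - u}" "(B has_integral I) {0..1}"
    using assms(1) unfolding has_simplex_integral_def by blast
  then show ?thesis
    unfolding has_simplex_integral_def
    by (intro exI[of _ "\<lambda>u v. x * A u v"] exI[of _ "\<lambda>u. x * B u"])
      (simp add: has_integral_mult_right)
qed

lemma has_triangle_integral_add:
  assumes "has_triangle_integral G I" "has_triangle_integral H J"
  shows "has_triangle_integral (\<lambda>u v. G u v + H u v) (I + J)"
proof -
  obtain A where "\<forall>v\<in>{0..1}. ((\<lambda>u. G u v) has_integral A v) {0..1 - v}" "(A has_integral I) {0..1}"
    using assms(1) unfolding has_triangle_integral_def by blast
  moreover obtain C where "\<forall>v\<in>{0..1}. ((\<lambda>u. H u v) has_integral C v) {0..1 - v}"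
    "(C has_integral J) {0..1}"
    using assms(2) unfolding has_triangle_integral_def by blast
  ultimately show ?thesis
    unfolding has_triangle_integral_def
    by (intro exI[of _ "\<lambda>v. A v + C v"]) (simp add: has_integral_add)
qed

lemma has_triangle_integral_scale:
  assumes "has_triangle_integral G I"
  shows "has_triangle_integral (\<lambda>u v. x * G u v) (x * I)"
proof -
  obtain A where "\<forall>v\<in>{0..1}. ((\<lambda>u. G u v) has_integral A v) {0..1 - v}" "(A has_integral I) {0..1}"
    using assms(1) unfolding has_triangle_integral_def by blast
  then show ?thesis
    unfolding has_triangle_integral_def
    by (intro exI[of _ "\<lambda>v. x * A v"]) (simp add: has_integral_mult_right)
qed

lemma has_integral_complex_of_real:
  "(f has_integral I) S \<Longrightarrow> ((\<lambda>x. complex_of_real (f x)) has_integral of_real I) S"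
  by (drule has_integral_linear[OF _ bounded_linear_of_real]) (simp add: o_def)

text \<open>Dirichlet's integral as three beta integrals with L = 1-u-v, 1-u and 1; each power of L
  becomes the second factor of the next integrand.\<close>

lemma has_simplex_integral_monomial:
  "has_simplex_integral (\<lambda>u v w. of_real (u ^ i * v ^ j * w ^ k))
     (of_real (fact i * fact j * fact k / fact (i + j + k + 3)))"
  unfolding has_simplex_integral_def
proof (intro exI conjI ballI)
  fix u v :: real
  assume u: "u \<in> {0..1}" and v: "v \<in> {0..1 - u}"
  \<comment> \<open>The zeroth power makes the innermost integral an instance of
    \<open>has_integral_beta\<close>.\<close>
  have "((\<lambda>w. u ^ i * v ^ j * (w ^ k * (1 - u - v - w) ^ 0)) has_integral
      u ^ i * v ^ j * (fact k * fact 0 / fact (k + 0 + 1) * (1 - u - v) ^ (k + 0 + 1))) {0..1 - u - v}"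
    by (intro has_integral_mult_right has_integral_beta) (use v in simp)
  then show "((\<lambda>w. complex_of_real (u ^ i * v ^ j * w ^ k)) has_integral
      of_real (u ^ i * v ^ j * (fact k / fact (k + 1) * (1 - u - v) ^ (k + 1)))) {0..1 - u - v}"
    by (intro has_integral_complex_of_real) (simp only: power_0 fact_0 mult_1_right add_0_right)
next
  fix u :: real
  assume u: "u \<in> {0..1}"
  have "((\<lambda>v. u ^ i * (fact k / fact (k + 1)) * (v ^ j * (1 - u - v) ^ (k + 1))) has_integral
      u ^ i * (fact k / fact (k + 1)) *
        (fact j * fact (k + 1) / fact (j + (k + 1) + 1) * (1 - u) ^ (j + (k + 1) + 1))) {0..1 - u}"
    by (intro has_integral_mult_right has_integral_beta) (use u in simp)
  then show "((\<lambda>v. complex_of_real (u ^ i * v ^ j * (fact k / fact (k + 1) * (1 - u - v) ^ (k + 1))))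
      has_integral of_real (u ^ i * (fact k / fact (k + 1)) *
        (fact j * fact (k + 1) / fact (j + (k + 1) + 1) * (1 - u) ^ (j + (k + 1) + 1)))) {0..1 - u}"
    by (intro has_integral_complex_of_real) (simp only: mult_ac)
next
  have "((\<lambda>u. fact j * fact k / fact (j + k + 2) * (u ^ i * (1 - u) ^ (j + k + 2))) has_integral
      fact j * fact k / fact (j + k + 2) * (fact i * fact (j + k + 2) / fact (i + (j + k + 2) + 1)
        * 1 ^ (i + (j + k + 2) + 1))) {0..1::real}"
    by (intro has_integral_mult_right has_integral_beta) simp
  also have "fact j * fact k / fact (j + k + 2) * (fact i * fact (j + k + 2) / fact (i + (j + k + 2) + 1)
        * 1 ^ (i + (j + k + 2) + 1)) = (fact i * fact j * fact k / fact (i + j + k + 3) :: real)"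
    by (simp add: add_ac numeral_3_eq_3 del: fact_Suc)
  also have "(\<lambda>u::real. fact j * fact k / fact (j + k + 2) * (u ^ i * (1 - u) ^ (j + k + 2))) =
      (\<lambda>u. u ^ i * (fact k / fact (k + 1)) *
        (fact j * fact (k + 1) / fact (j + (k + 1) + 1) * (1 - u) ^ (j + (k + 1) + 1)))"
    by (rule ext) (simp del: fact_Suc power_Suc)
  finally show "((\<lambda>u. complex_of_real (u ^ i * (fact k / fact (k + 1)) *
        (fact j * fact (k + 1) / fact (j + (k + 1) + 1) * (1 - u) ^ (j + (k + 1) + 1))))
      has_integral of_real (fact i * fact j * fact k / fact (i + j + k + 3))) {0..1}"
    by (rule has_integral_complex_of_real)
qed

text \<open>On the slanted face w = (1-v) - u, so the inner integral is a beta integral with L =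
  1-v.\<close>

lemma has_triangle_integral_monomial:
  "has_triangle_integral (\<lambda>u v. of_real (u ^ i * v ^ j * (1 - u - v) ^ k))
     (of_real (fact i * fact j * fact k / fact (i + j + k + 2)))"
  unfolding has_triangle_integral_def
proof (intro exI conjI ballI)
  fix v :: real
  assume v: "v \<in> {0..1}"
  show "((\<lambda>u. complex_of_real (u ^ i * v ^ j * (1 - u - v) ^ k)) has_integral
      of_real (fact i * fact k / fact (i + k + 1) * (v ^ j * (1 - v) ^ (i + k + 1)))) {0..1 - v}"
    using has_integral_mult_right[OF has_integral_beta[of "1 - v" i k], of "v ^ j"] v
    by (intro has_integral_complex_of_real) (simp add: algebra_simps del: power_Suc fact_Suc)
next
  have "((\<lambda>v. fact i * fact k / fact (i + k + 1) * (v ^ j * (1 - v) ^ (i + k + 1))) has_integral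
      fact i * fact k / fact (i + k + 1) * (fact j * fact (i + k + 1) / fact (j + (i + k + 1) + 1)
        * 1 ^ (j + (i + k + 1) + 1))) {0..1::real}"
    by (intro has_integral_mult_right has_integral_beta) simp
  also have "fact i * fact k / fact (i + k + 1) * (fact j * fact (i + k + 1) / fact (j + (i + k + 1) + 1)
        * 1 ^ (j + (i + k + 1) + 1)) = (fact i * fact j * fact k / fact (i + j + k + 2) :: real)"
    by (simp add: add_ac del: fact_Suc)
  finally show "((\<lambda>v. complex_of_real (fact i * fact k / fact (i + k + 1)
        * (v ^ j * (1 - v) ^ (i + k + 1)))) has_integral
      of_real (fact i * fact j * fact k / fact (i + j + k + 2))) {0..1}"
    by (rule has_integral_complex_of_real)
qed

section \<open>Divergence theorem on the simplex\<close>

text \<open>The divergence theorem for the field \<open>(u, v, w) G\<close>, whose divergence is \<open>3 G + G'\<close> and whose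
  flux through the faces containing the origin vanishes.\<close>

lemma euler_poly_divergence:
  assumes "euler_poly G G'"
  shows "\<exists>I J. has_simplex_integral G I \<and> has_simplex_integral G' (J - 3 * I) \<and>
           has_triangle_integral (\<lambda>u v. G u v (1 - u - v)) J"
  using assms
proof induction
  case (monomial i j k)
  define I J where "I = complex_of_real (fact i * fact j * fact k / fact (i + j + k + 3))"
    and "J = complex_of_real (fact i * fact j * fact k / fact (i + j + k + 2))"
  define N where "N = i + j + k + 2"
  have N: "i + j + k + 3 = Suc N"
    by (simp add: N_def)
  \<comment> \<open>The factorials in the denominators differ by the factor N + 1 = (i+j+k) + 3: the
    degree from the Euler operator plus the divergence 3 of the position field.\<close>
  have "of_nat (Suc N) * I = J"
    unfolding I_def J_def N N_def[symmetric] by (simp add: fact_Suc del: of_nat_Suc)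
  then have "of_nat (i + j + k) * I = J - 3 * I"
    by (simp add: N_def algebra_simps)
  moreover have "has_simplex_integral (\<lambda>u v w. of_real (u ^ i * v ^ j * w ^ k)) I"
    unfolding I_def by (rule has_simplex_integral_monomial)
  moreover from has_simplex_integral_scale[OF this, of "of_nat (i + j + k)"] calculation(1)
  have "has_simplex_integral (\<lambda>u v w. of_nat (i + j + k) * of_real (u ^ i * v ^ j * w ^ k)) (J - 3 * I)"
    by (simp only:)
  moreover have "has_triangle_integral (\<lambda>u v. of_real (u ^ i * v ^ j * (1 - u - v) ^ k)) J"
    unfolding J_def by (rule has_triangle_integral_monomial)
  ultimately show ?case
    by blast
next
  case (scale G G' x)
  then obtain I J where *: "has_simplex_integral G I" "has_simplex_integral G' (J - 3 * I)"
    "has_triangle_integral (\<lambda>u v. G u v (1 - u - v)) J"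
    by blast
  show ?case
    using *(1,2)[THEN has_simplex_integral_scale, of x] *(3)[THEN has_triangle_integral_scale, of x]
    by (intro exI[of _ "x * I"] exI[of _ "x * J"]) (simp add: algebra_simps)
next
  case (add G G' H H')
  then obtain I J where G: "has_simplex_integral G I" "has_simplex_integral G' (J - 3 * I)"
    "has_triangle_integral (\<lambda>u v. G u v (1 - u - v)) J"
    by blast
  from add obtain K L where H: "has_simplex_integral H K" "has_simplex_integral H' (L - 3 * K)"
    "has_triangle_integral (\<lambda>u v. H u v (1 - u - v)) L"
    by blast
  show ?case
    using has_simplex_integral_add[OF G(1) H(1)] has_simplex_integral_add[OF G(2) H(2)]
      has_triangle_integral_add[OF G(3) H(3)]
    by (intro exI[of _ "I + K"] exI[of _ "J + L"]) (simp add: algebra_simps)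
qed

section \<open>The recurrence for the simplex integrals\<close>

theorem lemma4:
  fixes Ru Rv Rw R0 :: "real ^ 3" and n :: nat and m :: int and \<xi>0 \<eta>0 :: complex
  assumes "n \<ge> 1" and "- int n \<le> m" and "m \<le> int n"
    and "\<xi>0 = (of_real (R0 $ 1) + \<i> * of_real (R0 $ 2)) / 2"
    and "\<eta>0 = (of_real (R0 $ 1) - \<i> * of_real (R0 $ 2)) / 2"
  shows "coeff_a Ru Rv Rw R0 n m =
           1 / (of_nat n + 3) *
             (\<i> * \<xi>0 * coeff_a Ru Rv Rw R0 (n - 1) (m - 1)
              + \<i> * \<eta>0 * coeff_a Ru Rv Rw R0 (n - 1) (m + 1)
              - of_real (R0 $ 3) * coeff_a Ru Rv Rw R0 (n - 1) m
              + coeff_b Ru Rv Rw R0 n m)"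
proof -
  \<comment> \<open>Both maps include the factor \<open>\<i>\<close>, so at \<open>R0\<close> they
    give \<open>\<i> * \<eta>0\<close> and \<open>\<i> * \<xi>0\<close>.\<close>
  define \<eta> \<xi> :: "real ^ 3 \<Rightarrow> complex"
    where "\<eta> = (\<lambda>r. \<i> * ((of_real (r $ 1) - \<i> * of_real (r $ 2)) / 2))"
      and "\<xi> = (\<lambda>r. \<i> * ((of_real (r $ 1) + \<i> * of_real (r $ 2)) / 2))"
  define c a d where "c = (\<lambda>u v w. \<eta> (affine_R Ru Rv Rw R0 u v w))"
    and "a = (\<lambda>u v w. - complex_of_real (affine_R Ru Rv Rw R0 u v w $ 3))"
    and "d = (\<lambda>u v w. \<xi> (affine_R Ru Rv Rw R0 u v w))"
  define T where "T = (\<lambda>n m u v w. trinom (c u v w) (a u v w) (d u v w) n m)"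
  define \<zeta>0 where "\<zeta>0 = - complex_of_real (R0 $ 3)"
  define E where "E = (\<lambda>n m u v w. of_nat n * ((c u v w - \<eta> R0) * T (n - 1) (m + 1) u v w
      + (a u v w - \<zeta>0) * T (n - 1) m u v w + (d u v w - \<xi> R0) * T (n - 1) (m - 1) u v w))"
  have T_coeff: "coeff_c Ru Rv Rw R0 n m = (\<lambda>u v w. 1 / fact n * T n m u v w)" for n m
    by (simp add: fun_eq_iff coeff_c_def harmonic_R_trinom T_def c_def a_def d_def \<eta>_def \<xi>_def)
  have "euler_poly (T n m) (E n m)" for n m
    unfolding T_def E_def
    by (rule euler_poly_trinom[where ?c1.0 = "\<eta> Ru" and ?c2.0 = "\<eta> Rv" and ?c3.0 = "\<eta> Rw"
          and ?a1.0 = "- of_real (Ru $ 3)" and ?a2.0 = "- of_real (Rv $ 3)"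
          and ?a3.0 = "- of_real (Rw $ 3)" and ?d1.0 = "\<xi> Ru" and ?d2.0 = "\<xi> Rv" and ?d3.0 = "\<xi> Rw"])
      (simp_all add: c_def a_def d_def \<eta>_def \<xi>_def \<zeta>0_def affine_R_def algebra_simps add_divide_distrib
        diff_divide_distrib)
  then have "\<exists>I J. has_simplex_integral (T n m) I \<and> has_simplex_integral (E n m) (J - 3 * I) \<and>
      has_triangle_integral (\<lambda>u v. T n m u v (1 - u - v)) J" for n m
    by (rule euler_poly_divergence)
  then obtain I J where I: "\<And>n m. has_simplex_integral (T n m) (I n m)"
    and E: "\<And>n m. has_simplex_integral (E n m) (J n m - 3 * I n m)"
    and J: "\<And>n m. has_triangle_integral (\<lambda>u v. T n m u v (1 - u - v)) (J n m)"
    by metis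
  have coeff_a: "coeff_a Ru Rv Rw R0 n m = I n m / fact n" for n m
    using has_simplex_integral_integral[OF has_simplex_integral_scale[OF I, of "1 / fact n" n m]]
    by (simp add: coeff_a_def T_coeff)
  have coeff_b: "coeff_b Ru Rv Rw R0 n m = J n m / fact n" for n m
    using has_triangle_integral_integral[OF has_triangle_integral_scale[OF J, of "1 / fact n" n m]]
    by (simp add: coeff_b_def coeff_d_def T_coeff)
  obtain k where n: "n = Suc k"
    using assms(1) by (cases n) auto
  \<comment> \<open>Splitting each difference such as \<open>c - \<eta> R0\<close>, the full
    coefficients reassemble to \<open>T n m\<close> by the trinomial recursion; the constants leave
    terms of degree k = n - 1.\<close>
  have E_eq: "E n m = (\<lambda>u v w. (of_nat n * T n m u v w + (- of_nat n * \<eta> R0) * T k (m + 1) u v w)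
      + ((- of_nat n * \<zeta>0) * T k m u v w + (- of_nat n * \<xi> R0) * T k (m - 1) u v w))"
    by (simp add: fun_eq_iff E_def T_def n algebra_simps)
  have "has_simplex_integral (E n m) ((of_nat n * I n m + (- of_nat n * \<eta> R0) * I k (m + 1))
      + ((- of_nat n * \<zeta>0) * I k m + (- of_nat n * \<xi> R0) * I k (m - 1)))"
    unfolding E_eq by (intro has_simplex_integral_add has_simplex_integral_scale I)
  \<comment> \<open>The integral of \<open>E n m\<close> is computed twice, by the divergence
    theorem and by the splitting; both values equal the same iterated integral.\<close>
  from has_simplex_integral_integral[OF this] has_simplex_integral_integral[OF E[of n m]]
  have "J n m - 3 * I n m = (of_nat n * I n m + (- of_nat n * \<eta> R0) * I k (m + 1))
      + ((- of_nat n * \<zeta>0) * I k m + (- of_nat n * \<xi> R0) * I k (m - 1))"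
    by simp
  then have "(of_nat n + 3) * I n m =
      of_nat n * (\<xi> R0 * I k (m - 1) + \<eta> R0 * I k (m + 1) + \<zeta>0 * I k m) + J n m"
    by (simp add: algebra_simps)
  \<comment> \<open>Dividing by n! = n k! absorbs the factor n and restores the normalization of the
    lower-degree integrals.\<close>
  then have "(of_nat n + 3) * (I n m / fact n) =
      \<xi> R0 * (I k (m - 1) / fact k) + \<eta> R0 * (I k (m + 1) / fact k) + \<zeta>0 * (I k m / fact k)
      + J n m / fact n"
    by (simp add: n field_simps del: of_nat_Suc)
  moreover have "of_nat n + 3 \<noteq> (0::complex)"
    using of_nat_eq_0_iff[of "n + 3", where ?'a = complex] by (simp del: of_nat_eq_0_iff)
  ultimately have "I n m / fact n = 1 / (of_nat n + 3) *
      (\<xi> R0 * (I k (m - 1) / fact k) + \<eta> R0 * (I k (m + 1) / fact k) + \<zeta>0 * (I k m / fact k)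
      + J n m / fact n)"
    by (metis nonzero_mult_div_cancel_left times_divide_eq_left mult_1_left)
  moreover have "\<xi> R0 = \<i> * \<xi>0" "\<eta> R0 = \<i> * \<eta>0" "n - 1 = k"
    by (simp_all add: \<xi>_def \<eta>_def assms(4,5) n)
  ultimately show ?thesis
    unfolding coeff_a coeff_b by (simp only: \<zeta>0_def) simp
qed

end
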